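(* Let $\lambda$ be a fixed partition of $n$, let $f:\mathbb{N}\to\mathbb{R}$ be an arbitrary function, and let $E_\lambda[d_f]$ be the expected value of the descent function $d_f$ on a uniformly random standard Young tableau of shape $\lambda$. Then $$E_\lambda[d_f]=c(\lambda)\cdot\sum_{i=1}^{n-1} f(i),$$ where $$c(\lambda):=\frac{\binom{n}{2}-\sum_i\binom{\lambda_i}{2}+\sum_j\binom{\lambda'_j}{2}}{n(n-1)}.$$
   Context: For a partition $\lambda=(\lambda_1\ge\lambda_2\ge\dots\ge\lambda_k)$ of $n$, $\lambda_i$ is the length of the $i$-th row of the Young diagram of shape $\lambda$ and $\lambda'_j$ is the length of its $j$-th column (so $\lambda'$ is the conjugate partition). Diagrams are drawn in English convention (row 1 on top). A standard Young tableau of shape $\lambda$ is a filling of the diagram with $1,\dots,n$, each used once, increasing along rows (left to right) and columns (top to bottom). A descent in a standard Young tableau $T$ is an entry $i$ (with $1\le i\le n-1$) such that $i+1$ lies strictly south (and weakly west) of $i$, equivalently, $i+1$ is in a strictly lower row (larger row index) than $i$; $D(T)$ is the set of descents of $T$. For $f:\mathbb{N}\to\mathbb{R}$, the descent function is $d_f(T):=\sum_{i\in D(T)} f(i)$. Random tableaux of shape $\lambda$ are chosen uniformly among all standard Young tableaux of shape $\lambda$. *)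

theory Defs
  imports "HOL-Probability.Probability_Mass_Function"
begin

definition is_partition_of :: "nat list \<Rightarrow> nat \<Rightarrow> bool" where
  "is_partition_of l n \<longleftrightarrow> sorted_wrt (\<ge>) l \<and> 0 \<notin> set l \<and> sum_list l = n"

(* Cells are (row, column), both counted from 0; row 0 is the top row. *)
definition young_diagram :: "nat list \<Rightarrow> (nat \<times> nat) set" where
  "young_diagram l = {(r, c). r < length l \<and> c < l ! r}"

(* The number of columns is the length of the first row. *)
definition conjugate_partition :: "nat list \<Rightarrow> nat list" where
  "conjugate_partition l =
     map (\<lambda>c. card {r. (r, c) \<in> young_diagram l})
       [0..<(case l of [] \<Rightarrow> 0 | a # _ \<Rightarrow> a)]"

(* Tableaux are undefined off the diagram, so that each filling of the
   diagram corresponds to exactly one function. *)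
definition standard_tableaux :: "nat list \<Rightarrow> (nat \<times> nat \<Rightarrow> nat) set" where
  "standard_tableaux l =
     {T \<in> extensional (young_diagram l).
        bij_betw T (young_diagram l) {1..sum_list l} \<and>
        (\<forall>r c c'. c < c' \<longrightarrow> (r, c) \<in> young_diagram l \<longrightarrow> (r, c') \<in> young_diagram l
           \<longrightarrow> T (r, c) < T (r, c')) \<and>
        (\<forall>r r' c. r < r' \<longrightarrow> (r, c) \<in> young_diagram l \<longrightarrow> (r', c) \<in> young_diagram l
           \<longrightarrow> T (r, c) < T (r', c))}"

definition descent_set :: "nat list \<Rightarrow> (nat \<times> nat \<Rightarrow> nat) \<Rightarrow> nat set" where
  "descent_set l T =
     {i. 1 \<le> i \<and> i < sum_list l \<and>
         (\<exists>r c r' c'. (r, c) \<in> young_diagram l \<and> (r', c') \<in> young_diagram l \<and>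
            T (r, c) = i \<and> T (r', c') = i + 1 \<and> r < r')}"

definition descent_fun :: "nat list \<Rightarrow> (nat \<Rightarrow> real) \<Rightarrow> (nat \<times> nat \<Rightarrow> nat) \<Rightarrow> real" where
  "descent_fun l f T = (\<Sum>i\<in>descent_set l T. f i)"

definition expected_descent :: "nat list \<Rightarrow> (nat \<Rightarrow> real) \<Rightarrow> real" where
  "expected_descent l f =
     measure_pmf.expectation (pmf_of_set (standard_tableaux l)) (descent_fun l f)"

(* For sum_list l \<le> 1 the denominator vanishes and the value is 0. *)
definition descent_coeff :: "nat list \<Rightarrow> real" where
  "descent_coeff l =
     (let n = sum_list l in
       (real (n choose 2)
          - (\<Sum>a\<leftarrow>l. real (a choose 2))
          + (\<Sum>b\<leftarrow>conjugate_partition l. real (b choose 2)))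
       / (real n * (real n - 1)))"

end

theory Submission
  imports Defs "HOL-Combinatorics.Transposition"
begin

text \<open>
  The number of tableaux having \<open>i\<close> as a descent does not depend on \<open>i\<close>: Haiman's elementary
  dual equivalence, which exchanges two of the entries \<open>i\<close>, \<open>i + 1\<close>, \<open>i + 2\<close>, matches the tableaux
  in which exactly \<open>i\<close> is a descent with those in which exactly \<open>i + 1\<close> is. Call this number \<open>A\<close>
  and the number of all tableaux \<open>N\<close>.

  To find \<open>A\<close>, write \<open>c(m)\<close> for the content (column minus row) of the cell containing \<open>m\<close>.
  Summed over all tableaux, \<open>c(i + 1) - c(i)\<close> gives \<open>N - 2 * A\<close>: if \<open>i\<close> and \<open>i + 1\<close> are neighbours,
  the difference is \<open>1\<close> or \<open>-1\<close> according to whether \<open>i\<close> is an ascent or a descent, and otherwise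
  exchanging them pairs off the tableaux so that both sides cancel. As \<open>c(1) = 0\<close>, the sum of \<open>c(m)\<close>
  is \<open>(m - 1) * (N - 2 * A)\<close>, and summing over \<open>m\<close> gives \<open>N\<close> times the total content of the diagram,
  which is the difference of the two sums of binomial coefficients over rows and columns.
\<close>

section \<open>Young diagrams and the existence of standard tableaux\<close>

locale partition_shape =
  fixes l :: "nat list"
  assumes sorted: "sorted_wrt (\<ge>) l"
begin

abbreviation Y where "Y \<equiv> young_diagram l"
abbreviation n where "n \<equiv> sum_list l"
abbreviation SYT where "SYT \<equiv> standard_tableaux l"

lemma young_diagram_eq_Sigma: "Y = Sigma {..<length l} (\<lambda>r. {..<l ! r})"
  by (auto simp: young_diagram_def)

lemma finite_diagram: "finite Y"
  by (simp add: young_diagram_eq_Sigma)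

lemma card_diagram: "card Y = n"
  by (simp add: young_diagram_eq_Sigma sum_list_sum_nth atLeast0LessThan)

lemma diagram_downward_closed:
  assumes "(r, c) \<in> Y" "r' \<le> r" "c' \<le> c"
  shows "(r', c') \<in> Y"
proof -
  have "l ! r \<le> l ! r'" 
    using sorted assms by (cases "r = r'") (auto simp: young_diagram_def sorted_wrt_iff_nth_less)
  then show ?thesis using assms by (auto simp: young_diagram_def)
qed

lemma finite_SYT: "finite SYT"
proof (rule finite_subset)
  show "SYT \<subseteq> Y \<rightarrow>\<^sub>E {1..n}"
    by (auto simp: standard_tableaux_def bij_betw_def PiE_def)
  show "finite (Y \<rightarrow>\<^sub>E {1..n})"
    by (simp add: finite_PiE finite_diagram)
qed

text \<open>The uniform distribution requires a nonempty set. The witness is the row-by-row filling: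
  each cell receives its rank in the lexicographic order \<open>le\<close>.\<close>

lemma SYT_nonempty: "SYT \<noteq> {}"
proof -
  define le where "le x y \<longleftrightarrow> fst x < fst y \<or> fst x = fst y \<and> snd x \<le> snd y" for x y :: "nat \<times> nat"
  define T where "T = restrict (\<lambda>x. card {y \<in> Y. le y x}) Y"
  have less: "T x < T y" if "x \<in> Y" "y \<in> Y" "\<not> le y x" for x y
  proof -
    have "{z \<in> Y. le z x} \<subseteq> {z \<in> Y. le z y}" using that by (auto simp: le_def)
    moreover have "y \<in> {z \<in> Y. le z y} - {z \<in> Y. le z x}" using that by (auto simp: le_def)
    ultimately have "{z \<in> Y. le z x} \<subset> {z \<in> Y. le z y}" by blast
    then show ?thesis using that finite_diagram by (simp add: T_def psubset_card_mono)
  qed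
  have inj: "inj_on T Y"
  proof (rule inj_onI)
    fix x y assume xy: "x \<in> Y" "y \<in> Y" "T x = T y"
    then have "le x y" "le y x" using less by (metis less_irrefl)+
    then show "x = y" by (auto simp: le_def prod_eq_iff)
  qed
  have "T ` Y \<subseteq> {1..n}"
  proof
    fix k assume "k \<in> T ` Y"
    then obtain x where x: "x \<in> Y" "k = card {y \<in> Y. le y x}" by (auto simp: T_def)
    have "card {y \<in> Y. le y x} \<le> card Y" by (rule card_mono) (auto simp: finite_diagram)
    moreover have "card {y \<in> Y. le y x} > 0"
      using x(1) finite_diagram by (simp add: card_gt_0_iff) (metis le_def order_refl surj_pair)
    ultimately show "k \<in> {1..n}" using x(2) card_diagram by simp
  qed
  then have "bij_betw T Y {1..n}"
    using inj card_diagram by (simp add: bij_betw_def card_image card_subset_eq)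
  then have "T \<in> SYT"
    using less by (force simp: standard_tableaux_def T_def le_def)
  then show ?thesis by blast
qed

text \<open>Compare through the corner \<open>(r, c')\<close>, which lies in the diagram by downward
  closure.\<close>

lemma SYT_mono:
  assumes "T \<in> SYT" "(r', c') \<in> Y" "r \<le> r'" "c \<le> c'"
  shows "T (r, c) \<le> T (r', c')"
proof -
  have "T (r, c) \<le> T (r, c')" "T (r, c') \<le> T (r', c')"
    using assms diagram_downward_closed[of r' c']
    by (cases "c = c'"; cases "r = r'"; force simp: standard_tableaux_def intro: less_imp_le)+
  then show ?thesis by simp
qed

section \<open>Positions of the entries\<close>

definition cell :: "(nat \<times> nat \<Rightarrow> nat) \<Rightarrow> nat \<Rightarrow> nat \<times> nat" where
  "cell T m = inv_into Y T m"

definition row :: "(nat \<times> nat \<Rightarrow> nat) \<Rightarrow> nat \<Rightarrow> nat" where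
  "row T m = fst (cell T m)"

definition col :: "(nat \<times> nat \<Rightarrow> nat) \<Rightarrow> nat \<Rightarrow> nat" where
  "col T m = snd (cell T m)"

context
  fixes T
  assumes T: "T \<in> SYT"
begin

lemma SYT_bij: "bij_betw T Y {1..n}"
  using T by (simp add: standard_tableaux_def)

lemma cell_mem: "m \<in> {1..n} \<Longrightarrow> cell T m \<in> Y"
  using SYT_bij by (auto simp: cell_def bij_betw_def intro: inv_into_into)

lemma row_col_mem: "m \<in> {1..n} \<Longrightarrow> (row T m, col T m) \<in> Y"
  using cell_mem by (simp add: row_def col_def)

lemma SYT_cell: "m \<in> {1..n} \<Longrightarrow> T (cell T m) = m"
  using SYT_bij by (auto simp: cell_def bij_betw_def intro: f_inv_into_f)

lemma SYT_row_col: "m \<in> {1..n} \<Longrightarrow> T (row T m, col T m) = m"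
  using SYT_cell by (simp add: row_def col_def)

lemma cell_SYT: "x \<in> Y \<Longrightarrow> cell T (T x) = x"
  using SYT_bij by (auto simp: cell_def bij_betw_def)

lemma row_SYT: "(r, c) \<in> Y \<Longrightarrow> row T (T (r, c)) = r"
  by (simp add: row_def cell_SYT)

lemma col_SYT: "(r, c) \<in> Y \<Longrightarrow> col T (T (r, c)) = c"
  by (simp add: col_def cell_SYT)

lemma cell_bij: "bij_betw (cell T) {1..n} Y"
  unfolding cell_def[abs_def] by (rule bij_betw_inv_into[OF SYT_bij])

lemma entry_le:
  assumes "a \<in> {1..n}" "b \<in> {1..n}" "row T a \<le> row T b" "col T a \<le> col T b"
  shows "a \<le> b"
  using SYT_mono[OF T row_col_mem[OF assms(2)] assms(3,4)] assms(1,2) by (simp add: SYT_row_col)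

text \<open>The rectangle with \<open>a\<close> at its upper left and \<open>b\<close> at its lower
  right corner lies in the diagram, and monotonicity bounds its entries by \<open>a\<close> and
  \<open>b\<close>. For close \<open>a\<close> and \<open>b\<close> few candidates remain.\<close>

lemma between:
  assumes "a \<in> {1..n}" "b \<in> {1..n}" "row T a \<le> r" "r \<le> row T b" "col T a \<le> c" "c \<le> col T b"
  obtains m where "m \<in> {a..b}" "row T m = r" "col T m = c"
proof
  have mem: "(r, c) \<in> Y" using diagram_downward_closed row_col_mem assms by blast
  show "row T (T (r, c)) = r" "col T (T (r, c)) = c" by (simp_all add: mem row_SYT col_SYT)
  show "T (r, c) \<in> {a..b}"
    using SYT_mono[OF T mem, of "row T a" "col T a"] 
      SYT_mono[OF T row_col_mem[OF assms(2)], of r c] assms by (simp add: SYT_row_col)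
qed

lemma mem_descent_set_iff:
  "i \<in> descent_set l T \<longleftrightarrow> 1 \<le> i \<and> i < n \<and> row T i < row T (i + 1)"
proof
  assume "i \<in> descent_set l T"
  then show "1 \<le> i \<and> i < n \<and> row T i < row T (i + 1)"
    unfolding descent_set_def by (smt (verit, best) mem_Collect_eq row_SYT)
next
  assume i: "1 \<le> i \<and> i < n \<and> row T i < row T (i + 1)"
  then have "i \<in> {1..n}" "i + 1 \<in> {1..n}" by auto
  then show "i \<in> descent_set l T" unfolding descent_set_def
    using i row_col_mem SYT_row_col by blast
qed

text \<open>A cell strictly between those of \<open>i\<close> and \<open>i + 1\<close> would need an
  entry strictly between two consecutive numbers.\<close>

lemma same_row_col:
  assumes "1 \<le> i" "i < n" "row T i = row T (i + 1)"
  shows "col T (i + 1) = col T i + 1"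
proof (rule ccontr)
  assume ne: "col T (i + 1) \<noteq> col T i + 1"
  have mem: "i \<in> {1..n}" "i + 1 \<in> {1..n}" using assms by auto
  have "col T i < col T (i + 1)" using entry_le[OF mem(2,1)] assms by fastforce
  with ne between[OF mem, of "row T i" "col T i + 1"] assms
  obtain m where "m \<in> {i..i + 1}" "col T m = col T i + 1" by auto
  then have "m = i \<or> m = i + 1" by auto
  then show False using ne \<open>col T m = _\<close> by auto
qed

lemma same_col_row:
  assumes "1 \<le> i" "i < n" "col T i = col T (i + 1)"
  shows "row T (i + 1) = row T i + 1"
proof (rule ccontr)
  assume ne: "row T (i + 1) \<noteq> row T i + 1"
  have mem: "i \<in> {1..n}" "i + 1 \<in> {1..n}" using assms by auto
  have "row T i < row T (i + 1)" using entry_le[OF mem(2,1)] assms by fastforce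
  with ne between[OF mem, of "row T i + 1" "col T i"] assms
  obtain m where "m \<in> {i..i + 1}" "row T m = row T i + 1" by auto
  then have "m = i \<or> m = i + 1" by auto
  then show False using ne \<open>row T m = _\<close> by auto
qed

end

section \<open>Exchanging consecutive entries\<close>

abbreviation (input) \<tau> :: "nat \<Rightarrow> nat \<Rightarrow> nat" where
  "\<tau> j \<equiv> Transposition.transpose j (j + 1)"

definition swap :: "nat \<Rightarrow> (nat \<times> nat \<Rightarrow> nat) \<Rightarrow> nat \<times> nat \<Rightarrow> nat" where
  "swap j T = restrict (\<tau> j \<circ> T) Y"

text \<open>Exchanging \<open>j\<close> and \<open>j + 1\<close> reverses the order of this pair
  only, and the pair shares neither a row nor a column.\<close>

lemma swap_SYT:
  assumes T: "T \<in> SYT" and j: "1 \<le> j" "j < n"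
    and "row T j \<noteq> row T (j + 1)" "col T j \<noteq> col T (j + 1)"
  shows "swap j T \<in> SYT"
proof -
  have less: "\<tau> j (T (r, c)) < \<tau> j (T (r', c'))"
    if "T (r, c) < T (r', c')" "(r, c) \<in> Y" "(r', c') \<in> Y" "r = r' \<or> c = c'" for r c r' c'
  proof -
    have "\<not> (T (r, c) = j \<and> T (r', c') = j + 1)"
      using that assms row_SYT[OF T] col_SYT[OF T] by metis
    then show ?thesis using that(1) by (auto simp: Transposition.transpose_def)
  qed
  have "bij_betw (\<tau> j) {1..n} {1..n}"
    using j by (intro bij_betw_byWitness[where f' = "\<tau> j"]) (auto simp: Transposition.transpose_def)
  then have "bij_betw (swap j T) Y {1..n}"
    using bij_betw_trans[OF SYT_bij[OF T]] bij_betw_cong[of Y "swap j T" "\<tau> j \<circ> T"] 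
    by (simp add: swap_def)
  moreover have "\<forall>r c c'. c < c' \<longrightarrow> (r, c) \<in> Y \<longrightarrow> (r, c') \<in> Y \<longrightarrow> swap j T (r, c) < swap j T (r, c')"
    "\<forall>r r' c. r < r' \<longrightarrow> (r, c) \<in> Y \<longrightarrow> (r', c) \<in> Y \<longrightarrow> swap j T (r, c) < swap j T (r', c)"
    using T less by (simp_all add: swap_def standard_tableaux_def)
  ultimately show ?thesis by (simp add: standard_tableaux_def swap_def)
qed

lemma cell_swap:
  assumes T: "T \<in> SYT" and S: "swap j T \<in> SYT" and j: "1 \<le> j" "j < n" and m: "m \<in> {1..n}"
  shows "cell (swap j T) m = cell T (\<tau> j m)"
proof -
  have k: "\<tau> j m \<in> {1..n}" using j m by (auto simp: Transposition.transpose_def)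
  have "swap j T (cell T (\<tau> j m)) = m"
    using cell_mem[OF T k] SYT_cell[OF T k] by (simp add: swap_def)
  then show ?thesis using cell_SYT[OF S cell_mem[OF T k]] by simp
qed

lemma row_swap:
  assumes "T \<in> SYT" "swap j T \<in> SYT" "1 \<le> j" "j < n" "m \<in> {1..n}"
  shows "row (swap j T) m = row T (\<tau> j m)"
  using cell_swap[OF assms] by (simp add: row_def)

lemma col_swap:
  assumes "T \<in> SYT" "swap j T \<in> SYT" "1 \<le> j" "j < n" "m \<in> {1..n}"
  shows "col (swap j T) m = col T (\<tau> j m)"
  using cell_swap[OF assms] by (simp add: col_def)

lemma swap_swap: "T \<in> SYT \<Longrightarrow> swap j (swap j T) = T"
  by (auto simp: swap_def fun_eq_iff restrict_def standard_tableaux_def extensional_def)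

section \<open>Elementary dual equivalence and constancy of the descent counts\<close>

text \<open>In reading order (rows from bottom to top), this exchanges the middle one of the three entries
  with the farther of the other two, whenever it does not already lie between them.\<close>

definition dual_swap :: "nat \<Rightarrow> (nat \<times> nat \<Rightarrow> nat) \<Rightarrow> nat \<times> nat \<Rightarrow> nat" where
  "dual_swap i T =
     (if row T i < row T (i + 2) \<longleftrightarrow> row T i < row T (i + 1) then swap i T else swap (i + 1) T)"

text \<open>By \<open>ne\<close>, exactly one of \<open>i\<close> and \<open>i + 1\<close> is a
  descent. The row of \<open>i + 2\<close> (first case) or of \<open>i\<close> (second case) then
  lies between the rows of the other two entries. Exchanging those two leaves the case unchanged and
  moves the descent.\<close>

lemma dual_swap:
  assumes T: "T \<in> SYT" and i: "1 \<le> i" "i + 1 < n"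
    and ne: "row T i < row T (i + 1) \<longleftrightarrow> \<not> row T (i + 1) < row T (i + 2)"
  shows "dual_swap i T \<in> SYT" "dual_swap i (dual_swap i T) = T"
    "row (dual_swap i T) i < row (dual_swap i T) (i + 1) \<longleftrightarrow> row T (i + 1) < row T (i + 2)"
    "row (dual_swap i T) (i + 1) < row (dual_swap i T) (i + 2) \<longleftrightarrow> row T i < row T (i + 1)"
proof -
  have mem: "i \<in> {1..n}" "i + 1 \<in> {1..n}" "i + 2 \<in> {1..n}" using i by auto
  note le = entry_le[OF T]
  have mid: "m = i + 1" if "m \<in> {i..i+2}" "m \<noteq> i" "m \<noteq> i + 2" for m using that by auto
  have *: "dual_swap i T \<in> SYT \<and> dual_swap i (dual_swap i T) = T \<and>
    (row (dual_swap i T) i < row (dual_swap i T) (i + 1) \<longleftrightarrow> row T (i + 1) < row T (i + 2)) \<and>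
    (row (dual_swap i T) (i + 1) < row (dual_swap i T) (i + 2) \<longleftrightarrow> row T i < row T (i + 1))"
  proof (cases "row T i < row T (i + 2) \<longleftrightarrow> row T i < row T (i + 1)")
    case True
    have neq: "row T i \<noteq> row T (i + 1)" using True ne by auto
    \<comment> \<open>In a common column, \<open>i + 1\<close> would lie below \<open>i\<close>. The
      cell in the row of \<open>i\<close> and the column of \<open>i + 2\<close> could then contain
      only \<open>i + 1\<close>, which is in a lower row.\<close>
    have "col T i \<noteq> col T (i + 1)"
    proof
      assume c: "col T i = col T (i + 1)"
      then have r: "row T i < row T (i + 1)" using le[OF mem(2,1)] neq by fastforce
      then have r2: "row T i < row T (i + 2)" "row T (i + 2) \<le> row T (i + 1)" using True ne by auto
      then have c2: "col T i < col T (i + 2)" using le[OF mem(3,2)] c by fastforce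
      obtain m where m: "m \<in> {i..i + 2}" "row T m = row T i" "col T m = col T (i + 2)"
        by (rule between[OF T mem(1,3), of "row T i" "col T (i + 2)"]) (use r2 c2 in auto)
      have "m = i + 1" using m r2 c2 by (intro mid) auto
      then show False using m r by simp
    qed
    then have S: "swap i T \<in> SYT" using swap_SYT[OF T _ _ neq] i by simp
    have "row (swap i T) i = row T (i + 1)" "row (swap i T) (i + 1) = row T i"
      "row (swap i T) (i + 2) = row T (i + 2)"
      using i mem row_swap[OF T S] by simp_all
    then show ?thesis using S True ne T by (auto simp: dual_swap_def swap_swap)
  next
    case False
    have neq: "row T (i + 1) \<noteq> row T (i + 2)" using False ne by auto
    \<comment> \<open>Symmetrically, the cell in the row of \<open>i + 2\<close> and the column of
      \<open>i\<close> could contain only \<open>i + 1\<close>, which is in a higher row.\<close>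
    have "col T (i + 1) \<noteq> col T (i + 2)"
    proof
      assume c: "col T (i + 1) = col T (i + 2)"
      then have r: "row T (i + 1) < row T (i + 2)" using le[OF mem(3,2)] neq by fastforce
      then have r2: "row T i < row T (i + 2)" "row T (i + 1) \<le> row T i" using False ne by auto
      then have c2: "col T i < col T (i + 2)" using le[OF mem(2,1)] c by fastforce
      obtain m where m: "m \<in> {i..i + 2}" "row T m = row T (i + 2)" "col T m = col T i"
        by (rule between[OF T mem(1,3), of "row T (i + 2)" "col T i"]) (use r2 c2 in auto)
      have "m = i + 1" using m r2 c2 by (intro mid) auto
      then show False using m r by simp
    qed
    then have S: "swap (i + 1) T \<in> SYT" using swap_SYT[OF T, of "i + 1"] neq i by simp
    have "row (swap (i + 1) T) i = row T i" "row (swap (i + 1) T) (i + 1) = row T (i + 2)"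
      "row (swap (i + 1) T) (i + 2) = row T (i + 1)"
      using i mem row_swap[OF T S] by simp_all
    then show ?thesis using S False ne T by (auto simp: dual_swap_def swap_swap)
  qed
  from * show "dual_swap i T \<in> SYT" "dual_swap i (dual_swap i T) = T"
    "row (dual_swap i T) i < row (dual_swap i T) (i + 1) \<longleftrightarrow> row T (i + 1) < row T (i + 2)"
    "row (dual_swap i T) (i + 1) < row (dual_swap i T) (i + 2) \<longleftrightarrow> row T i < row T (i + 1)"
    by blast+
qed

abbreviation desc_count :: "nat \<Rightarrow> nat" where
  "desc_count i \<equiv> card {T \<in> SYT. row T i < row T (i + 1)}"

text \<open>Tableaux with both descents (\<open>?C\<close>) count on both sides;
  \<open>dual_swap\<close> matches the others.\<close>

lemma desc_count_Suc:
  assumes i: "1 \<le> i" "i + 1 < n"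
  shows "desc_count (i + 1) = desc_count i"
proof -
  let ?A = "{T \<in> SYT. row T i < row T (i + 1) \<and> \<not> row T (i + 1) < row T (i + 2)}"
  let ?B = "{T \<in> SYT. \<not> row T i < row T (i + 1) \<and> row T (i + 1) < row T (i + 2)}"
  let ?C = "{T \<in> SYT. row T i < row T (i + 1) \<and> row T (i + 1) < row T (i + 2)}"
  have "bij_betw (dual_swap i) ?A ?B"
    by (rule bij_betw_byWitness[where f' = "dual_swap i"]) (auto simp: dual_swap[OF _ i, simplified])
  then have eq: "card ?A = card ?B" by (rule bij_betw_same_card)
  have "desc_count i = card (?A \<union> ?C)" by (rule arg_cong[where f = card]) auto
  also have "\<dots> = card ?A + card ?C" by (rule card_Un_disjoint) (auto simp: finite_SYT)
  also have "\<dots> = card ?B + card ?C" using eq by simp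
  also have "\<dots> = card (?B \<union> ?C)" by (rule card_Un_disjoint[symmetric]) (auto simp: finite_SYT)
  also have "\<dots> = desc_count (i + 1)" by (rule arg_cong[where f = card]) (auto simp: numeral_2_eq_2)
  finally show ?thesis by simp
qed

lemma desc_count_eq:
  assumes "1 \<le> i" "i < n"
  shows "desc_count i = desc_count 1"
  using assms
proof (induction i rule: nat_induct_at_least)
  case (Suc i)
  then show ?case using desc_count_Suc[of i] by simp
qed simp

section \<open>Contents of entries, summed over all tableaux\<close>

definition content :: "(nat \<times> nat \<Rightarrow> nat) \<Rightarrow> nat \<Rightarrow> real" where
  "content T m = real (col T m) - real (row T m)"

text \<open>The involution \<open>h\<close> negates the summand, so the sum equals its own negative.
  An exchange negates the content difference and toggles the descent at \<open>i\<close>.\<close>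

lemma sum_content_step:
  assumes i: "1 \<le> i" "i < n"
  shows "(\<Sum>T\<in>SYT. content T (i + 1) - content T i - 1
            + 2 * of_bool (row T i < row T (i + 1))) = 0" (is "sum ?g SYT = 0")
proof -
  define h where "h T = (if row T i \<noteq> row T (i + 1) \<and> col T i \<noteq> col T (i + 1) then swap i T else T)" for T
  have h: "h T \<in> SYT \<and> h (h T) = T \<and> ?g (h T) = - ?g T" if T: "T \<in> SYT" for T
  proof (cases "row T i \<noteq> row T (i + 1) \<and> col T i \<noteq> col T (i + 1)")
    case True
    then have S: "swap i T \<in> SYT" using swap_SYT T i by blast
    have "row (swap i T) i = row T (i + 1)" "row (swap i T) (i + 1) = row T i"
      "col (swap i T) i = col T (i + 1)" "col (swap i T) (i + 1) = col T i"
      using i row_swap[OF T S] col_swap[OF T S] by simp_all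
    then show ?thesis using S True T by (auto simp: h_def swap_swap content_def)
  next
    case False
    \<comment> \<open>Tableaux fixed by \<open>h\<close> have \<open>i\<close> and
      \<open>i + 1\<close> in adjacent cells, and there the summand is \<open>0\<close>.\<close>
    then consider "row T (i + 1) = row T i" "col T (i + 1) = col T i + 1"
      | "col T (i + 1) = col T i" "row T (i + 1) = row T i + 1"
      using same_row_col[OF T i] same_col_row[OF T i] by fastforce
    then show ?thesis using T by cases (simp_all add: h_def content_def)
  qed
  have "sum ?g SYT = (\<Sum>T\<in>SYT. - ?g T)"
  proof (rule sum.reindex_bij_witness[of _ h h])
    show "- ?g (h T) = ?g T" if "T \<in> SYT" for T using h[OF that] by linarith
  qed (use h in blast)+
  also have "\<dots> = - sum ?g SYT" by (rule sum_negf)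
  finally show ?thesis by linarith
qed

lemma sum_content_diff:
  assumes "1 \<le> i" "i < n"
  shows "(\<Sum>T\<in>SYT. content T (i + 1)) - (\<Sum>T\<in>SYT. content T i)
    = real (card SYT) - 2 * real (desc_count 1)"
proof -
  have "(\<Sum>T\<in>SYT. of_bool (row T i < row T (i + 1))) = real (desc_count i)"
    using finite_SYT by (simp add: sum_of_bool_eq Int_def)
  then show ?thesis using sum_content_step[OF assms] desc_count_eq[OF assms]
    by (simp add: sum.distrib sum_subtractf sum_distrib_left[symmetric])
qed

lemma sum_content:
  assumes "1 \<le> m" "m \<le> n"
  shows "(\<Sum>T\<in>SYT. content T m) = (real m - 1) * (real (card SYT) - 2 * real (desc_count 1))"
  using assms
proof (induction m rule: nat_induct_at_least)
  case base
  \<comment> \<open>The corner cell is weakly northwest of the cell of \<open>1\<close>, so its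
    entry is at most \<open>1\<close> and hence equal to \<open>1\<close>.\<close>
  have "content T 1 = 0" if T: "T \<in> SYT" for T
  proof -
    have one: "1 \<in> {1..n}" using base by simp
    obtain m where "m \<in> {1..n}" "row T m = 0" "col T m = 0"
    proof
      have mem: "(0, 0) \<in> Y" using diagram_downward_closed row_col_mem[OF T one] by blast
      then show "T (0, 0) \<in> {1..n}" using SYT_bij[OF T] by (auto simp: bij_betw_def)
      show "row T (T (0, 0)) = 0" "col T (T (0, 0)) = 0"
        using mem row_SYT[OF T] col_SYT[OF T] by simp_all
    qed
    moreover from this have "m \<le> 1" using entry_le[OF T _ one] by simp
    ultimately show ?thesis using one by (cases "m = 1") (auto simp: content_def)
  qed
  then show ?case by simp
next
  case (Suc m)
  then show ?case using sum_content_diff[of m] by (simp add: algebra_simps)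
qed

section \<open>Total content of the diagram\<close>

lemma two_times_choose_two: "2 * real (k choose 2) = real k * (real k - 1)"
  by (induction k) (simp_all add: numeral_2_eq_2 algebra_simps)

lemma sum_lessThan_real: "(\<Sum>c<k. real c) = real (k choose 2)"
  by (induction k) (simp_all add: numeral_2_eq_2)

text \<open>Downward closure makes each column an initial segment of rows, so its length determines
  it.\<close>

lemma diagram_column: "{r. (r, c) \<in> Y} = {..<card {r. (r, c) \<in> Y}}"
proof -
  let ?S = "{r. (r, c) \<in> Y}"
  have fin: "finite ?S" by (rule finite_subset[of _ "{..<length l}"]) (auto simp: young_diagram_def)
  show ?thesis
  proof (cases "?S = {}")
    case False
    have "?S = {..<Suc (Max ?S)}"
    proof (intro equalityI subsetI)
      fix r assume "r \<in> {..<Suc (Max ?S)}"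
      moreover have "Max ?S \<in> ?S" using fin False by (rule Max_in)
      ultimately show "r \<in> ?S" using diagram_downward_closed[of "Max ?S" c r c] by simp
    qed (use fin in \<open>auto simp: less_Suc_eq_le intro: Max_ge\<close>)
    then show ?thesis by (metis card_lessThan)
  qed simp
qed

lemma sum_cols: "(\<Sum>(r, c)\<in>Y. real c) = (\<Sum>a\<leftarrow>l. real (a choose 2))"
  by (simp add: young_diagram_eq_Sigma sum.Sigma[symmetric] sum_lessThan_real sum_list_sum_nth atLeast0LessThan)

lemma sum_rows: "(\<Sum>(r, c)\<in>Y. real r) = (\<Sum>b\<leftarrow>conjugate_partition l. real (b choose 2))"
proof -
  let ?w = "case l of [] \<Rightarrow> 0 | a # _ \<Rightarrow> a"
  have w: "c < ?w" if "(r, c) \<in> Y" for r c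
    using diagram_downward_closed[OF that, of 0 c] by (cases l) (auto simp: young_diagram_def)
  \<comment> \<open>Transposing the diagram turns the sum into one over columns, indexed as in
    \<open>conjugate_partition\<close>.\<close>
  have "(\<Sum>(r, c)\<in>Y. real r) = (\<Sum>(c, r)\<in>Sigma {..<?w} (\<lambda>c. {r. (r, c) \<in> Y}). real r)"
    by (rule sum.reindex_bij_witness[of _ prod.swap prod.swap]) (use w in auto)
  also have "\<dots> = (\<Sum>c<?w. \<Sum>r | (r, c) \<in> Y. real r)"
    by (rule sum.Sigma[symmetric]) (auto, subst diagram_column, simp)
  also have "\<dots> = (\<Sum>c<?w. real (card {r. (r, c) \<in> Y} choose 2))"
    by (subst diagram_column) (simp add: sum_lessThan_real)
  finally show ?thesis
    by (simp add: conjugate_partition_def sum_list_sum_nth atLeast0LessThan)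
qed

text \<open>The entries visit every cell exactly once, so the sum is the same for every
  \<open>T\<close>.\<close>

lemma sum_content_tableau:
  assumes T: "T \<in> SYT"
  shows "(\<Sum>m=1..n. content T m)
    = (\<Sum>a\<leftarrow>l. real (a choose 2)) - (\<Sum>b\<leftarrow>conjugate_partition l. real (b choose 2))"
proof -
  have "(\<Sum>m=1..n. content T m) = (\<Sum>m=1..n. (\<lambda>(r, c). real c - real r) (cell T m))"
    by (simp add: content_def row_def col_def case_prod_beta)
  also have "\<dots> = (\<Sum>(r, c)\<in>Y. real c - real r)"
    by (rule sum.reindex_bij_betw[OF cell_bij[OF T]])
  also have "\<dots> = (\<Sum>(r, c)\<in>Y. real c) - (\<Sum>(r, c)\<in>Y. real r)"
    by (simp add: case_prod_beta sum_subtractf)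
  finally show ?thesis by (simp add: sum_cols sum_rows)
qed

section \<open>The descent probability and the expectation\<close>

lemma desc_count_ratio:
  assumes n: "n \<ge> 2"
  shows "real (desc_count 1) / real (card SYT) = descent_coeff l"
proof -
  let ?N = "real (card SYT)" and ?A = "real (desc_count 1)"
  let ?C = "(\<Sum>a\<leftarrow>l. real (a choose 2)) - (\<Sum>b\<leftarrow>conjugate_partition l. real (b choose 2))"
  have N: "?N > 0" using SYT_nonempty finite_SYT by (simp add: card_gt_0_iff)
  have b: "(\<Sum>m=1..n. real m - 1) = real (n choose 2)"
    using sum.shift_bounds_Suc_ivl[of "\<lambda>m. real m - 1" 0 n]
    by (simp add: sum_lessThan_real atLeast0LessThan atLeastLessThanSuc_atLeastAtMost)
  \<comment> \<open>Double counting: the contents of all entries in all tableaux are summed first by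
    tableau, then by entry.\<close>
  have "?N * ?C = (\<Sum>T\<in>SYT. \<Sum>m=1..n. content T m)"
    by (simp add: sum_content_tableau del: One_nat_def)
  also have "\<dots> = (\<Sum>m=1..n. \<Sum>T\<in>SYT. content T m)" by (rule sum.swap)
  also have "\<dots> = (\<Sum>m=1..n. (real m - 1) * (?N - 2 * ?A))"
    by (rule sum.cong[OF refl], rule sum_content) auto
  also have "\<dots> = real (n choose 2) * (?N - 2 * ?A)"
    by (simp add: b sum_distrib_right[symmetric] del: One_nat_def)
  finally have eq: "?N * ?C = real (n choose 2) * (?N - 2 * ?A)" .
  have c: "2 * real (n choose 2) = real n * (real n - 1)"
    by (rule two_times_choose_two)
  have pos: "real n * (real n - 1) > 0" using n by simp
  have "?A * (2 * real (n choose 2)) = ?N * (real (n choose 2) - ?C)"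
    using eq by (simp add: algebra_simps)
  then have "?A * (real n * (real n - 1)) = ?N * (real (n choose 2) - ?C)"
    by (simp only: c)
  then have "?A / ?N = (real (n choose 2) - ?C) / (real n * (real n - 1))"
    using N pos by (subst frac_eq_eq) (auto simp only: mult.commute less_irrefl)
  then show ?thesis by (simp add: descent_coeff_def Let_def algebra_simps)
qed

text \<open>Linearity of expectation, with \<open>descent_fun\<close> expanded into indicators of
  the single descents.\<close>

lemma expected_descent_eq:
  "expected_descent l f = (\<Sum>i=1..n - 1. f i * (real (desc_count i) / real (card SYT)))"
proof -
  have d: "descent_fun l f T = (\<Sum>i=1..n - 1. f i * of_bool (row T i < row T (i + 1)))"
    if "T \<in> SYT" for T
  proof -
    have "descent_set l T = {1..n - 1} \<inter> {i. row T i < row T (i + 1)}"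
      by (rule set_eqI) (use mem_descent_set_iff[OF that] in \<open>simp, linarith\<close>)
    then show ?thesis unfolding descent_fun_def by (simp add: sum.inter_restrict of_bool_def if_distrib cong: if_cong)
  qed
  have "expected_descent l f = (\<Sum>T\<in>SYT. descent_fun l f T) / card SYT"
    unfolding expected_descent_def by (rule integral_pmf_of_set) (fact SYT_nonempty finite_SYT)+
  also have "(\<Sum>T\<in>SYT. descent_fun l f T)
      = (\<Sum>i=1..n - 1. \<Sum>T\<in>SYT. f i * of_bool (row T i < row T (i + 1)))"
    by (subst sum.swap) (simp add: d)
  also have "\<dots> = (\<Sum>i=1..n - 1. f i * real (desc_count i))"
    using finite_SYT by (simp add: sum_distrib_left[symmetric] sum_of_bool_eq Int_def)
  finally show ?thesis by (simp add: sum_divide_distrib)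
qed

end

theorem theorem1:
  fixes l :: "nat list" and n :: nat and f :: "nat \<Rightarrow> real"
  assumes "is_partition_of l n"
  shows "expected_descent l f = descent_coeff l * (\<Sum>i = 1..n - 1. f i)"
proof -
  interpret partition_shape l
    using assms by unfold_locales (simp add: is_partition_of_def)
  have n: "n = sum_list l" using assms by (simp add: is_partition_of_def)
  have "real (card {T \<in> standard_tableaux l. row T i < row T (i + 1)}) / real (card (standard_tableaux l))
      = descent_coeff l" if "i \<in> {1..n - 1}" for i
  proof -
    \<comment> \<open>An index in the range forces \<open>n\<close> to be at least \<open>2\<close>,
      where the denominator of \<open>descent_coeff\<close> is nonzero; for smaller \<open>n\<close>
      the sum is empty.\<close>
    have "1 \<le> i" "i < sum_list l" "2 \<le> sum_list l" using that n by auto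
    then show ?thesis using desc_count_eq[of i] desc_count_ratio by simp
  qed
  then show ?thesis
    by (simp add: expected_descent_eq n[symmetric] sum_distrib_left mult.commute)
qed

end
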